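(* Let $\mathbb{K}$ be a field of characteristic different from $2$. Then there are no $(4,4)$-nets in $\mathbb{P}^2_{\mathbb{K}}$.
   Context: Let $p\ge3$ be an integer. A $p$-net in $\mathbb{P}^2$ is a $(p+1)$-tuple $(\mathcal{A}_1,\ldots,\mathcal{A}_p,\mathcal{X})$, where each $\mathcal{A}_i$ is a nonempty finite set of lines of $\mathbb{P}^2$ and $\mathcal{X}$ is a finite set of points of $\mathbb{P}^2$, satisfying: (1) the $\mathcal{A}_i$ are pairwise disjoint; (2) the intersection point of any line in $\mathcal{A}_i$ with any line in $\mathcal{A}_j$ belongs to $\mathcal{X}$ for $i\ne j$; (3) through every point in $\mathcal{X}$ there passes exactly one line of each $\mathcal{A}_i$. All the $\mathcal{A}_i$ then have the same cardinality $q$, called the degree of the net, and a $p$-net of degree $q$ is called a $(p,q)$-net. *)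

theory Defs
  imports "HOL-Analysis.Analysis"
begin

(* The projective plane over the field 'a: points and lines are the subspaces of 'a ^ 3 of
   dimension 1 and 2, and a point P lies on a line l iff P \<subseteq> l. *)

definition proj_points :: "('a::field ^ 3) set set" where
  "proj_points = {P. vec.subspace P \<and> vec.dim P = 1}"

definition proj_lines :: "('a::field ^ 3) set set" where
  "proj_lines = {l. vec.subspace l \<and> vec.dim l = 2}"

(* In this model the intersection point of two distinct lines is their set intersection. *)
lemma proj_lines_Int_in_proj_points:
  fixes l m :: "('a::field ^ 3) set"
  assumes l: "l \<in> proj_lines" and m: "m \<in> proj_lines" and "l \<noteq> m"
  shows "l \<inter> m \<in> proj_points"
proof -
  have sl: "vec.subspace l" "vec.dim l = 2" and sm: "vec.subspace m" "vec.dim m = 2"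
    using l m by (auto simp: proj_lines_def)
  have si: "vec.subspace (l \<inter> m)"
    using sl sm by (simp add: vec.subspace_inter)
  have "vec.dim {x + y |x y. x \<in> l \<and> y \<in> m} + vec.dim (l \<inter> m) = 4"
    using vec.dim_sums_Int[OF sl(1) sm(1)] sl sm by simp
  moreover have "vec.dim {x + y |x y. x \<in> l \<and> y \<in> m} \<le> 3"
    using dim_subset_UNIV_cart_gen[of "{x + y |x y. x \<in> l \<and> y \<in> m}"] by simp
  moreover have "vec.dim (l \<inter> m) < 2"
  proof (rule ccontr)
    assume "\<not> vec.dim (l \<inter> m) < 2"
    then have "l \<inter> m = l" "l \<inter> m = m"
      using vec.subspace_dim_equal[OF si sl(1)] vec.subspace_dim_equal[OF si sm(1)] sl sm
      by auto
    then show False using \<open>l \<noteq> m\<close> by simp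
  qed
  ultimately have "vec.dim (l \<inter> m) = 1" by linarith
  then show ?thesis using si by (simp add: proj_points_def)
qed

(* The tuple of line sets is A 1, ..., A p; the other values of A are irrelevant. *)
definition is_net ::
  "nat \<Rightarrow> (nat \<Rightarrow> ('a::field ^ 3) set set) \<Rightarrow> ('a ^ 3) set set \<Rightarrow> bool" where
  "is_net p A X \<longleftrightarrow>
     p \<ge> 3 \<and>
     (\<forall>i\<in>{1..p}. A i \<noteq> {} \<and> finite (A i) \<and> A i \<subseteq> proj_lines) \<and>
     finite X \<and> X \<subseteq> proj_points \<and>
     (\<forall>i\<in>{1..p}. \<forall>j\<in>{1..p}. i \<noteq> j \<longrightarrow> A i \<inter> A j = {}) \<and>
     (\<forall>i\<in>{1..p}. \<forall>j\<in>{1..p}. i \<noteq> j \<longrightarrow> (\<forall>l\<in>A i. \<forall>m\<in>A j. l \<inter> m \<in> X)) \<and>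
     (\<forall>P\<in>X. \<forall>i\<in>{1..p}. \<exists>!l. l \<in> A i \<and> P \<subseteq> l)"

lemma is_net_card_eq:
  assumes net: "is_net p A X" and i: "i \<in> {1..p}" and j: "j \<in> {1..p}"
  shows "card (A i) = card (A j)"
proof -
  from net have "p \<ge> 3"
    and lines: "\<forall>i\<in>{1..p}. A i \<noteq> {} \<and> finite (A i) \<and> A i \<subseteq> proj_lines"
    and pts: "X \<subseteq> proj_points"
    and meet: "\<forall>i\<in>{1..p}. \<forall>j\<in>{1..p}. i \<noteq> j \<longrightarrow> (\<forall>l\<in>A i. \<forall>m\<in>A j. l \<inter> m \<in> X)"
    and through: "\<forall>P\<in>X. \<forall>i\<in>{1..p}. \<exists>!l. l \<in> A i \<and> P \<subseteq> l"
    unfolding is_net_def by - (elim conjE, assumption)+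
  have "\<exists>k\<in>{1, 2, 3}. k \<noteq> i \<and> k \<noteq> j" by simp presburger
  moreover have "{1, 2, 3} \<subseteq> {1..p}" using \<open>p \<ge> 3\<close> by auto
  ultimately obtain k where k: "k \<in> {1..p}" "k \<noteq> i" "k \<noteq> j" by (meson subsetD)
  obtain l where l: "l \<in> A k" using lines[rule_format, OF k(1)] by auto
  have *: "card (A h) = card {P \<in> X. P \<subseteq> l}" if h: "h \<in> {1..p}" "h \<noteq> k" for h
  proof (rule bij_betw_same_card)
    have in_X: "m \<inter> l \<in> X" if "m \<in> A h" for m
      using meet[rule_format, OF h(1) k(1) h(2) that l] .
    have uniq: "\<exists>!m. m \<in> A h \<and> P \<subseteq> m" if "P \<in> X" for P
      using through[rule_format, OF that h(1)] .
    show "bij_betw (\<lambda>m. m \<inter> l) (A h) {P \<in> X. P \<subseteq> l}"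
      unfolding bij_betw_def
    proof (intro conjI set_eqI iffI)
      show "inj_on (\<lambda>m. m \<inter> l) (A h)"
      proof (rule inj_onI)
        fix m m' assume "m \<in> A h" "m' \<in> A h" "m \<inter> l = m' \<inter> l"
        then show "m = m'" using uniq[OF in_X[of m]] by (metis Int_lower1)
      qed
    next
      fix P assume "P \<in> (\<lambda>m. m \<inter> l) ` A h"
      then show "P \<in> {P \<in> X. P \<subseteq> l}" using in_X by auto
    next
      fix P assume P: "P \<in> {P \<in> X. P \<subseteq> l}"
      then obtain m where m: "m \<in> A h" "P \<subseteq> m" using uniq[of P] by auto
      have "P \<in> proj_points" "m \<inter> l \<in> proj_points" "P \<subseteq> m \<inter> l"
        using P m in_X pts by auto
      then have "P = m \<inter> l"
        unfolding proj_points_def using vec.subspace_dim_equal[of P "m \<inter> l"] by simp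
      then show "P \<in> (\<lambda>m. m \<inter> l) ` A h" using m by blast
    qed
  qed
  show ?thesis using *[OF i] *[OF j] k by simp
qed

definition is_net_of_degree ::
  "nat \<Rightarrow> nat \<Rightarrow> (nat \<Rightarrow> ('a::field ^ 3) set set) \<Rightarrow> ('a ^ 3) set set \<Rightarrow> bool" where
  "is_net_of_degree p q A X \<longleftrightarrow> is_net p A X \<and> (\<forall>i\<in>{1..p}. card (A i) = q)"

end

theory Submission
  imports Defs
begin

text \<open>
The four classes of a \<open>(4,4)\<close>-net encode two orthogonal Latin squares of order 4: index the cells
by \<open>x\<close> in the first class and \<open>y\<close> in the second, and write into the cell the lines \<open>f x y\<close> and
\<open>g x y\<close> of the third and fourth class through the point \<open>x \<inter> y\<close>. Such a pair is unique up to
relabelling. With the labels \<open>0, 1, 2, 3\<close> standing for the elements \<open>0, 1, \<omega>, \<omega>\<^sup>2\<close> of the field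
\<open>F\<^sub>4\<close>, it is \<open>f x\<^sub>i y\<^sub>j = z\<^sub>k\<close> with \<open>k = i + j\<close>, and \<open>g x\<^sub>i y\<^sub>j = v\<^sub>h\<close> with \<open>h = i + \<omega> j\<close>
(\<open>orthogonal_latin_squares_4\<close>). So the net has the incidences of the affine plane over \<open>F\<^sub>4\<close> with
one parallel class removed, and it remains to see that these force characteristic 2.

The lines with label 0 or 1 in the first three classes are the six sides of the quadrangle formed by
the points \<open>a = x\<^sub>1 \<inter> y\<^sub>0\<close>, \<open>b = x\<^sub>0 \<inter> y\<^sub>1\<close>, \<open>c = x\<^sub>1 \<inter> y\<^sub>1\<close> and \<open>d = x\<^sub>0 \<inter> y\<^sub>0\<close>. After rescaling,
\<open>d = a + b + c\<close> for a basis \<open>a, b, c\<close> (\<open>frame_scaling\<close>). Each of the lines \<open>v\<^sub>1\<close>, \<open>v\<^sub>2\<close>, \<open>v\<^sub>3\<close>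
contains exactly one of \<open>a\<close>, \<open>b\<close>, \<open>c\<close>, hence is determined by one parameter, different from 0 and 1
(\<open>slope\<close>):
  \<^item> \<open>v\<^sub>1\<close> contains \<open>a\<close> and \<open>m\<^sub>1 b + c\<close>,
  \<^item> \<open>v\<^sub>2\<close> contains \<open>b\<close> and \<open>m\<^sub>2 c + a\<close>,
  \<^item> \<open>v\<^sub>3\<close> contains \<open>c\<close> and \<open>m\<^sub>3 a + b\<close>.

The nine points where these three lines meet the sides not through \<open>a\<close>, \<open>b\<close>, \<open>c\<close> respectively are
therefore explicit (\<open>slope_points\<close>). Three of them lie on \<open>x\<^sub>2\<close> and three on \<open>x\<^sub>3\<close>; the two
vanishing determinants add up to \<open>(m\<^sub>2 - 1) (m\<^sub>1 + m\<^sub>3) = 0\<close>, so \<open>m\<^sub>1 + m\<^sub>3 = 0\<close>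
(\<open>opposite_slopes\<close>). The configuration is invariant under the cyclic shift
\<open>a \<rightarrow> b \<rightarrow> c \<rightarrow> a\<close>, which moves the classes by \<open>x \<rightarrow> z \<rightarrow> y \<rightarrow> x\<close>; so the same
argument gives \<open>m\<^sub>2 + m\<^sub>1 = 0\<close> and \<open>m\<^sub>3 + m\<^sub>2 = 0\<close>. Hence \<open>2 m\<^sub>1 = 0\<close> with \<open>m\<^sub>1 \<noteq> 0\<close>.
\<close>

section \<open>Orthogonal Latin squares of order 4\<close>

definition latin_square :: "'x set \<Rightarrow> 'y set \<Rightarrow> 'z set \<Rightarrow> ('x \<Rightarrow> 'y \<Rightarrow> 'z) \<Rightarrow> bool" where
  "latin_square X Y Z f \<longleftrightarrow>
     (\<forall>x\<in>X. bij_betw (f x) Y Z) \<and> (\<forall>y\<in>Y. bij_betw (\<lambda>x. f x y) X Z)"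

lemma latin_square_mem:
  "latin_square X Y Z f \<Longrightarrow> x \<in> X \<Longrightarrow> y \<in> Y \<Longrightarrow> f x y \<in> Z"
  unfolding latin_square_def by (meson bij_betwE)

lemma latin_square_row_inj:
  "latin_square X Y Z f \<Longrightarrow> x \<in> X \<Longrightarrow> y \<in> Y \<Longrightarrow> y' \<in> Y \<Longrightarrow> f x y = f x y' \<longleftrightarrow> y = y'"
  unfolding latin_square_def by (meson bij_betw_def inj_on_eq_iff)

lemma latin_square_col_inj:
  assumes "latin_square X Y Z f" "x \<in> X" "x' \<in> X" "y \<in> Y"
  shows "f x y = f x' y \<longleftrightarrow> x = x'"
proof -
  have "inj_on (\<lambda>x. f x y) X" using assms unfolding latin_square_def bij_betw_def by blast
  then show ?thesis using assms(2,3) by (metis inj_onD)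
qed

lemma latin_square_row_ex:
  assumes "latin_square X Y Z f" "x \<in> X" "z \<in> Z"
  obtains y where "y \<in> Y" "f x y = z"
proof -
  have "f x ` Y = Z" using assms unfolding latin_square_def bij_betw_def by blast
  then show ?thesis using assms that by blast
qed

lemma latin_square_col_ex:
  assumes "latin_square X Y Z f" "y \<in> Y" "z \<in> Z"
  obtains x where "x \<in> X" "f x y = z"
proof -
  have "(\<lambda>x. f x y) ` X = Z" using assms unfolding latin_square_def bij_betw_def by blast
  then show ?thesis using assms that by blast
qed

lemma card_4_eq:
  assumes "card S = 4" "{a, b, c, d} \<subseteq> S" "distinct [a, b, c, d]"
  shows "S = {a, b, c, d}"
proof -
  have "finite S" using assms(1) by (metis card.infinite zero_neq_numeral)
  moreover have "card {a, b, c, d} = 4" using assms(3) by simp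
  ultimately show ?thesis using card_subset_eq assms(1,2) by metis
qed

text \<open>
If columns \<open>y0\<close>, \<open>y1\<close> do not already give a subsquare with \<open>x0\<close>, then replacing the entry in column
\<open>y0\<close> by the one beside it in column \<open>y1\<close> is the 4-cycle \<open>z0, z1, z3, z2\<close>. A column whose entries
avoid both columns is the image of \<open>y0\<close> under the square or the inverse of this cycle; the column
\<open>y2\<close> chosen below belongs to the square. That is an involution, so the rows \<open>x0\<close> and \<open>x3\<close> have the
same two entries in \<open>y0\<close> and \<open>y2\<close>, interchanged.
\<close>

lemma latin_square_4_subsquare:
  assumes L: "latin_square X Y Z f" and card: "card X = 4" "card Y = 4" "card Z = 4"
  obtains x0 x1 y0 y1 where "x0 \<in> X" "x1 \<in> X" "y0 \<in> Y" "y1 \<in> Y" "x0 \<noteq> x1" "y0 \<noteq> y1"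
    "f x0 y0 = f x1 y1" "f x0 y1 = f x1 y0"
proof -
  note mem = latin_square_mem[OF L]
  note row = latin_square_row_inj[OF L]
  note col = latin_square_col_inj[OF L]
  obtain x0 where x0: "x0 \<in> X" using card(1) by fastforce
  obtain y0 where y0: "y0 \<in> Y" using card(2) by fastforce
  have "Y \<noteq> {y0}" using card(2) by auto
  then obtain y1 where "y1 \<in> Y" "y0 \<noteq> y1" using y0 by blast
  with y0 have y: "y0 \<in> Y" "y1 \<in> Y" "y0 \<noteq> y1" by auto
  obtain x1 where x1: "x1 \<in> X" "f x1 y1 = f x0 y0"
    using latin_square_col_ex[OF L y(2) mem[OF x0 y(1)]] by blast
  have ne01: "x0 \<noteq> x1" using x1(2) row[OF x0 y(1,2)] y(3) by auto
  show ?thesis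
  proof (cases "f x1 y0 = f x0 y1")
    case True
    then show ?thesis using that x0 x1 y ne01 by metis
  next
    case False
    define z0 z1 z2 where z: "z0 = f x0 y0" "z1 = f x0 y1" "z2 = f x1 y0"
    have zne: "z0 \<noteq> z1" "z0 \<noteq> z2" "z1 \<noteq> z2"
      using row[OF x0 y(1,2)] col[OF x0 x1(1) y(1)] y(3) ne01 False z by auto
    have zZ: "z0 \<in> Z" "z1 \<in> Z" "z2 \<in> Z" using mem x0 x1 y z by auto
    have "\<not> Z \<subseteq> {z0, z1, z2}"
    proof
      assume "Z \<subseteq> {z0, z1, z2}"
      then have "card Z \<le> card {z0, z1, z2}" by (intro card_mono) auto
      then show False using card(3) by (simp add: card_insert_if split: if_splits)
    qed
    then obtain z3 where z3: "z3 \<in> Z" "z3 \<noteq> z0" "z3 \<noteq> z1" "z3 \<noteq> z2" by blast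
    have Z: "Z = {z0, z1, z2, z3}"
      using card_4_eq[OF card(3), of z0 z1 z2 z3] zZ zne z3 by auto
    obtain x3 where x3: "x3 \<in> X" "f x3 y0 = z3" using latin_square_col_ex[OF L y(1) z3(1)] by blast
    have x3ne: "x3 \<noteq> x0" "x3 \<noteq> x1" using x3 z z3 by auto
    obtain y2 where y2: "y2 \<in> Y" "f x0 y2 = z3" using latin_square_row_ex[OF L x0 z3(1)] by blast
    have y2ne: "y2 \<noteq> y0" "y2 \<noteq> y1" using y2 z z3 by auto
    have c31: "f x3 y1 = z2"
      using mem[OF x3(1) y(2)] row[OF x3(1) y(2,1)] col[OF x3(1) x0 y(2)] col[OF x3(1) x1(1) y(2)]
        x3 x3ne x1 y z unfolding Z by auto
    have c12: "f x1 y2 = z1"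
      using mem[OF x1(1) y2(1)] col[OF x1(1) x0 y2(1)] row[OF x1(1) y2(1) y(1)]
        row[OF x1(1) y2(1) y(2)] y2 y2ne x1 ne01 z unfolding Z by auto
    have c32: "f x3 y2 = z0"
      using mem[OF x3(1) y2(1)] row[OF x3(1) y2(1) y(1)] row[OF x3(1) y2(1) y(2)]
        col[OF x3(1) x1(1) y2(1)] y2ne x3 x3ne c31 c12 unfolding Z by auto
    show ?thesis using that[of x0 x3 y0 y2] x0 x3 x3ne y y2 y2ne c32 z by auto
  qed
qed

text \<open>
Once a subsquare of \<open>f\<close> fixes the labels \<open>0\<close> and \<open>1\<close>, its four cells carry four different values of
\<open>g\<close>, which label the fourth alphabet; the row \<open>y0\<close> and the column \<open>x0\<close> of \<open>g\<close> then label the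
remaining rows and columns. Every other entry is forced, since all alternatives repeat an entry in a
row or a column or repeat a pair of entries. In particular orthogonality rules out the table of the
cyclic group. Listed are the cells whose second entry is \<open>v1\<close>, \<open>v2\<close> or \<open>v3\<close>, together with
\<open>(x0, y0)\<close>.
\<close>

lemma orthogonal_latin_squares_4:
  assumes F: "latin_square X Y Z f" and G: "latin_square X Y V g"
    and card: "card X = 4" "card Y = 4" "card Z = 4" "card V = 4"
    and orth: "\<And>x y x' y'. \<lbrakk>x \<in> X; y \<in> Y; x' \<in> X; y' \<in> Y; f x y = f x' y'; g x y = g x' y'\<rbrakk>
                 \<Longrightarrow> x = x' \<and> y = y'"
  obtains x0 x1 x2 x3 y0 y1 y2 y3 z0 z1 z2 z3 v0 v1 v2 v3 where
    "{x0, x1, x2, x3} \<subseteq> X" "distinct [x0, x1, x2, x3]"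
    "{y0, y1, y2, y3} \<subseteq> Y" "distinct [y0, y1, y2, y3]"
    "{z0, z1, z2, z3} \<subseteq> Z" "distinct [z0, z1, z2, z3]"
    "{v0, v1, v2, v3} \<subseteq> V" "distinct [v0, v1, v2, v3]"
    "f x0 y0 = z0" "f x0 y1 = z1" "f x0 y2 = z2" "f x0 y3 = z3"
    "f x1 y0 = z1" "f x1 y1 = z0" "f x1 y2 = z3"
    "f x2 y0 = z2" "f x2 y2 = z0" "f x2 y3 = z1"
    "f x3 y0 = z3" "f x3 y1 = z2" "f x3 y3 = z0"
    "g x0 y0 = v0" "g x0 y1 = v2" "g x0 y2 = v3" "g x0 y3 = v1"
    "g x1 y0 = v1" "g x1 y1 = v3" "g x1 y2 = v2"
    "g x2 y0 = v2" "g x2 y2 = v1" "g x2 y3 = v3"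
    "g x3 y0 = v3" "g x3 y1 = v1" "g x3 y3 = v2"
proof -
  note memf = latin_square_mem[OF F] and memg = latin_square_mem[OF G]
  note rowf = latin_square_row_inj[OF F] and rowg = latin_square_row_inj[OF G]
  note colf = latin_square_col_inj[OF F] and colg = latin_square_col_inj[OF G]
  obtain x0 x1 y0 y1 where X01: "x0 \<in> X" "x1 \<in> X" "x0 \<noteq> x1" and Y01: "y0 \<in> Y" "y1 \<in> Y" "y0 \<noteq> y1"
    and sub: "f x0 y0 = f x1 y1" "f x0 y1 = f x1 y0"
    using latin_square_4_subsquare[OF F card(1-3)] by metis
  obtain z0 z1 where z01: "f x0 y0 = z0" "f x0 y1 = z1" by blast
  have z01': "f x1 y0 = z1" "f x1 y1 = z0" using sub z01 by auto
  obtain v0 v1 v2 v3 where v: "g x0 y0 = v0" "g x1 y0 = v1" "g x0 y1 = v2" "g x1 y1 = v3" by blast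
  have vV: "{v0, v1, v2, v3} \<subseteq> V" using memg X01 Y01 v by blast
  have vd: "distinct [v0, v1, v2, v3]"
    using rowg[OF X01(1) Y01(1,2)] rowg[OF X01(2) Y01(1,2)] colg[OF X01(1,2) Y01(1)]
      colg[OF X01(1,2) Y01(2)] orth[OF X01(1) Y01(1) X01(2) Y01(2)]
      orth[OF X01(1) Y01(2) X01(2) Y01(1)] X01(3) Y01(3) sub v by auto
  have V: "V = {v0, v1, v2, v3}" using card_4_eq[OF card(4) vV vd] .
  obtain x2 where x2: "x2 \<in> X" "g x2 y0 = v2"
    using latin_square_col_ex[OF G Y01(1), of v2] V by blast
  obtain x3 where x3: "x3 \<in> X" "g x3 y0 = v3"
    using latin_square_col_ex[OF G Y01(1), of v3] V by blast
  obtain y2 where y2: "y2 \<in> Y" "g x0 y2 = v3"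
    using latin_square_row_ex[OF G X01(1), of v3] V by blast
  obtain y3 where y3: "y3 \<in> Y" "g x0 y3 = v1"
    using latin_square_row_ex[OF G X01(1), of v1] V by blast
  have xd: "distinct [x0, x1, x2, x3]" using x2 x3 v vd X01 by auto
  have yd: "distinct [y0, y1, y2, y3]" using y2 y3 v vd Y01 by auto
  obtain z2 z3 where z23: "f x2 y0 = z2" "f x3 y0 = z3" by blast
  note xs = X01(1,2) x2(1) x3(1) and ys = Y01(1,2) y2(1) y3(1)
  have zZ: "{z0, z1, z2, z3} \<subseteq> Z" using memf xs ys z01 z23 by blast
  have zd: "distinct [z0, z1, z2, z3]"
    using z01 z01' z23 xd colf[OF _ _ ys(1)] rowf[OF xs(1) ys(1,2)] Y01(3) xs by auto
  have Z: "Z = {z0, z1, z2, z3}" using card_4_eq[OF card(3) zZ zd] .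
  have fZ: "f x y = z0 \<or> f x y = z1 \<or> f x y = z2 \<or> f x y = z3" if "x \<in> X" "y \<in> Y" for x y
    using memf[OF that] Z by blast
  have gV: "g x y = v0 \<or> g x y = v1 \<or> g x y = v2 \<or> g x y = v3" if "x \<in> X" "y \<in> Y" for x y
    using memg[OF that] V by blast
  have d: "x0 \<noteq> x1" "x0 \<noteq> x2" "x0 \<noteq> x3" "x1 \<noteq> x2" "x1 \<noteq> x3" "x2 \<noteq> x3"
    "y0 \<noteq> y1" "y0 \<noteq> y2" "y0 \<noteq> y3" "y1 \<noteq> y2" "y1 \<noteq> y3" "y2 \<noteq> y3" using xd yd by auto
  have f02: "f x0 y2 = z2"
    using fZ[OF xs(1) ys(3)] rowf xs ys d z01 z23 orth x3 y2 by metis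
  have f03: "f x0 y3 = z3" using fZ[OF xs(1) ys(4)] rowf xs ys d z01 f02 by metis
  have f12: "f x1 y2 = z3" using fZ[OF xs(2) ys(3)] rowf colf xs ys d z01' f02 by metis
  have f13: "f x1 y3 = z2" using fZ[OF xs(2) ys(4)] rowf xs ys d z01' f12 by metis
  have f31: "f x3 y1 = z2" using fZ[OF xs(4) ys(2)] rowf colf xs ys d z01 z01' z23 by metis
  have f21: "f x2 y1 = z3" using fZ[OF xs(3) ys(2)] colf xs ys d z01 z01' f31 by metis
  have g13: "g x1 y3 = v0"
    using gV[OF xs(2) ys(4)] rowg xs ys d v orth f13 z23 x2 by metis
  have g12: "g x1 y2 = v2"
    using gV[OF xs(2) ys(3)] rowg xs ys d v g13 by metis
  have g21: "g x2 y1 = v0"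
    using gV[OF xs(3) ys(2)] colg xs ys d v orth f21 f03 y3 by metis
  have g31: "g x3 y1 = v1"
    using gV[OF xs(4) ys(2)] colg xs ys d v g21 by metis
  have g22: "g x2 y2 = v1"
    using gV[OF xs(3) ys(3)] rowg colg xs ys d x2 y2 g21 g12 by metis
  have g23: "g x2 y3 = v3"
    using gV[OF xs(3) ys(4)] rowg xs ys d x2 g21 g22 by metis
  have g32: "g x3 y2 = v0"
    using gV[OF xs(4) ys(3)] colg xs ys d y2 g12 g22 by metis
  have g33: "g x3 y3 = v2"
    using gV[OF xs(4) ys(4)] rowg xs ys d x3 g31 g32 by metis
  have f22: "f x2 y2 = z0"
    using fZ[OF xs(3) ys(3)] colf rowf xs ys d f02 f12 orth z01' v g22 by metis
  have f23: "f x2 y3 = z1"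
    using fZ[OF xs(3) ys(4)] rowf xs ys d z23 f21 f22 by metis
  have f33: "f x3 y3 = z0"
    using fZ[OF xs(4) ys(4)] colf xs ys d f03 f13 f23 by metis
  show ?thesis
    using that[of x0 x1 x2 x3 y0 y1 y2 y3 z0 z1 z2 z3 v0 v1 v2 v3] xs ys xd yd zZ zd vV vd
      z01 z01' z23 f02 f03 f12 f31 f22 f23 f33 v x2 x3 y2 y3 g12 g31 g22 g23 g33
    by (simp add: insert_subset)
qed

section \<open>Coordinates with respect to a quadrangle\<close>

lemma subspace_scale_iff:
  fixes u :: "'a::field ^ 'n"
  assumes "vec.subspace S" "r \<noteq> 0"
  shows "r *s u \<in> S \<longleftrightarrow> u \<in> S"
  using vec.subspace_scale[OF assms(1), of "r *s u" "inverse r"]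
    vec.subspace_scale[OF assms(1), of u r] assms(2) by auto

text \<open>
By Cramer's rule the determinant times \<open>a\<close> is a combination of the three given vectors. The subspace
avoids \<open>a\<close>, so the determinant vanishes.
\<close>

lemma subspace_det_eq_0:
  fixes a b c :: "'a::field ^ 3"
  assumes S: "vec.subspace S" and a: "a \<notin> S"
    and p: "p1 *s a + p2 *s b + p3 *s c \<in> S"
    and q: "q1 *s a + q2 *s b + q3 *s c \<in> S"
    and r: "r1 *s a + r2 *s b + r3 *s c \<in> S"
  shows "p1 * (q2 * r3 - q3 * r2) - p2 * (q1 * r3 - q3 * r1) + p3 * (q1 * r2 - q2 * r1) = 0"
    (is "?D = 0")
proof (rule ccontr)
  assume D: "?D \<noteq> 0"
  have "?D *s a = (q2 * r3 - q3 * r2) *s (p1 *s a + p2 *s b + p3 *s c)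
     + (p3 * r2 - p2 * r3) *s (q1 *s a + q2 *s b + q3 *s c)
     + (p2 * q3 - p3 * q2) *s (r1 *s a + r2 *s b + r3 *s c)"
    by (simp add: vec_eq_iff algebra_simps)
  also have "\<dots> \<in> S" by (intro vec.subspace_add[OF S] vec.subspace_scale[OF S] p q r)
  finally show False using subspace_scale_iff[OF S D] a by blast
qed

text \<open>
The collinearity conditions on \<open>S\<close> and on \<open>T\<close> share the monomial \<open>m1 m2 m3\<close> with opposite signs;
their sum factors as \<open>(m2 - 1) (m1 + m3)\<close>. The summands are ordered such that the
hypotheses for the cyclic shifts of \<open>a, b, c\<close> and \<open>m1, m2, m3\<close> are about literally the same nine
vectors.
\<close>

lemma opposite_slopes:
  fixes a b c :: "'a::field ^ 3"
  assumes S: "vec.subspace S" "a \<notin> S" and T: "vec.subspace T" "a \<notin> T"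
    and S1: "m1 *s a + m1 *s b + c \<in> S" and S2: "m2 *s b + m2 *s c + a \<in> S"
    and S3: "m3 *s a + b \<in> S"
    and T1: "m1 *s b + c \<in> T" and T2: "b + m2 *s c + a \<in> T" and T3: "c + m3 *s a + b \<in> T"
    and m2: "m2 \<noteq> 1"
  shows "m1 + m3 = 0"
proof -
  have "1 * (m1 * 0 - 1 * 1) - m2 * (m1 * 0 - 1 * m3) + m2 * (m1 * 1 - m1 * m3) = 0"
    by (rule subspace_det_eq_0[OF S, of _ _ b _ c]) (use S1 S2 S3 in \<open>simp_all add: ac_simps\<close>)
  moreover have "m3 * (m1 * m2 - 1 * 1) - 1 * (0 * m2 - 1 * 1) + 1 * (0 * 1 - m1 * 1) = 0"
    by (rule subspace_det_eq_0[OF T, of _ _ b _ c]) (use T1 T2 T3 in \<open>simp_all add: ac_simps\<close>)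
  ultimately have "(m2 - 1) * (m1 + m3) = 0" by algebra
  then show ?thesis using m2 by simp
qed

text \<open>
In the coordinates \<open>a, b, c\<close>, a line \<open>v\<close> through the vertex \<open>a\<close> of the triangle of reference is
recorded by its intersection \<open>m b + c\<close> with the opposite side \<open>l\<close>. Since \<open>v\<close> avoids the vertex \<open>c\<close>,
\<open>m\<close> is not 0, and since it avoids the unit point \<open>a + b + c\<close>, \<open>m\<close> is not 1.
\<close>

lemma slope:
  fixes a b c :: "'a::field ^ 3"
  assumes span: "vec.span {a, b, c} = UNIV"
    and v: "vec.subspace v" "a \<in> v" "b \<notin> v" "c \<notin> v" "a + b + c \<notin> v"
    and l: "vec.subspace l" "a \<notin> l" "b \<in> l" "c \<in> l"
    and w: "w \<in> v" "w \<in> l" "w \<noteq> 0"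
  obtains m where "m \<noteq> 0" "m \<noteq> 1" "m *s b + c \<in> v" "m *s b + c \<in> l"
proof -
  obtain \<alpha> \<beta> \<gamma> where w': "w = \<alpha> *s a + \<beta> *s b + \<gamma> *s c"
  proof -
    have "w \<in> vec.span {a, b, c}" using span by simp
    then obtain \<alpha> \<beta> \<gamma> where "w - \<alpha> *s a - \<beta> *s b - \<gamma> *s c = 0"
      by (auto simp: vec.span_insert)
    then show ?thesis using that[of \<alpha> \<beta> \<gamma>] by (simp add: algebra_simps)
  qed
  have "\<alpha> *s a = w - (\<beta> *s b + \<gamma> *s c)" using w' by simp
  also have "\<dots> \<in> l"
    by (intro vec.subspace_diff[OF l(1)] vec.subspace_add[OF l(1)] vec.subspace_scale[OF l(1)] w l)
  finally have \<alpha>: "\<alpha> = 0" using subspace_scale_iff[OF l(1)] l(2) by blast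
  have \<gamma>: "\<gamma> \<noteq> 0"
  proof
    assume "\<gamma> = 0"
    then have "\<beta> \<noteq> 0" "\<beta> *s b \<in> v" using w w' \<alpha> by auto
    then show False using subspace_scale_iff[OF v(1)] v(3) by blast
  qed
  define m where "m = \<beta> / \<gamma>"
  have "inverse \<gamma> *s w = m *s b + c"
    unfolding w' \<alpha> m_def using \<gamma> by (simp add: vec_eq_iff field_simps)
  then have mv: "m *s b + c \<in> v" and ml: "m *s b + c \<in> l"
    using vec.subspace_scale[OF v(1) w(1), of "inverse \<gamma>"]
      vec.subspace_scale[OF l(1) w(2), of "inverse \<gamma>"] by auto
  moreover have "m \<noteq> 0" using mv v(4) by auto
  moreover have "m \<noteq> 1"
    using mv vec.subspace_add[OF v(1,2) mv] v(5) by (auto simp: add.assoc)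
  ultimately show ?thesis using that by blast
qed

text \<open>
The two other sides of the quadrangle \<open>a, b, c, a + b + c\<close> that avoid \<open>a\<close> join the unit point to
\<open>b\<close> and to \<open>c\<close>; these are the intersections of \<open>v\<close> with them.
\<close>

lemma slope_points:
  fixes a b c :: "'a::field ^ 3"
  assumes "vec.subspace v" "a \<in> v" "m *s b + c \<in> v"
    "vec.subspace r" "b \<in> r" "a + b + c \<in> r"
    "vec.subspace s" "c \<in> s" "a + b + c \<in> s"
  shows "a + m *s b + c \<in> v \<inter> r" "m *s a + m *s b + c \<in> v \<inter> s"
proof -
  have "a + m *s b + c = a + (m *s b + c)" by simp
  then have 1: "a + m *s b + c \<in> v" using vec.subspace_add assms(1-3) by metis
  have "m *s a + m *s b + c = m *s a + (m *s b + c)" by simp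
  then have 2: "m *s a + m *s b + c \<in> v" using vec.subspace_add vec.subspace_scale assms(1-3) by metis
  have "a + m *s b + c = (a + b + c) + (m - 1) *s b" by (simp add: vec_eq_iff algebra_simps)
  then have 3: "a + m *s b + c \<in> r" using vec.subspace_add vec.subspace_scale assms(4-6) by metis
  have "m *s a + m *s b + c = m *s (a + b + c) + (1 - m) *s c" by (simp add: vec_eq_iff algebra_simps)
  then have 4: "m *s a + m *s b + c \<in> s" using vec.subspace_add vec.subspace_scale assms(7-9) by metis
  show "a + m *s b + c \<in> v \<inter> r" "m *s a + m *s b + c \<in> v \<inter> s" using 1 2 3 4 by auto
qed

text \<open>
Four points, no three collinear, form a projective frame. That no three are collinear is witnessed
here by the three sides \<open>k\<close>, \<open>l\<close>, \<open>m\<close> of the triangle \<open>a, b, c\<close>. The rescaled vectors span the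
same points, which the last three conclusions express as membership in the same subspaces.
\<close>

lemma frame_scaling:
  fixes a b c d :: "'a::field ^ 3"
  assumes sub: "vec.subspace k" "vec.subspace l" "vec.subspace m"
    and k: "b \<in> k" "c \<in> k" "a \<notin> k" "d \<notin> k"
    and l: "a \<in> l" "c \<in> l" "b \<notin> l" "d \<notin> l"
    and m: "a \<in> m" "b \<in> m" "c \<notin> m" "d \<notin> m"
  obtains a' b' c' where "vec.span {a', b', c'} = UNIV" "d = a' + b' + c'"
    "\<And>S. vec.subspace S \<Longrightarrow> a' \<in> S \<longleftrightarrow> a \<in> S"
    "\<And>S. vec.subspace S \<Longrightarrow> b' \<in> S \<longleftrightarrow> b \<in> S"
    "\<And>S. vec.subspace S \<Longrightarrow> c' \<in> S \<longleftrightarrow> c \<in> S"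
proof -
  have indep: "vec.independent {x, y, z} \<and> card {x, y, z} = 3"
    if "x \<notin> k" "y \<in> k" "z \<in> k" "z \<in> l'" "y \<notin> l'" "z \<noteq> 0" "vec.subspace l'" for x y z l'
  proof -
    have "y \<notin> vec.span {z}" using vec.span_minimal[of "{z}" l'] that by auto
    moreover have "x \<notin> vec.span {y, z}" using vec.span_minimal[of "{y, z}" k] that sub by auto
    moreover have "vec.independent {z}" using that(6) by simp
    ultimately have "vec.independent {x, y, z}"
      by (metis vec.independent_insertI)
    moreover have "x \<noteq> y" "x \<noteq> z" "y \<noteq> z" using that by auto
    ultimately show ?thesis by simp
  qed
  have full: "vec.span {x, y, z} = UNIV" if "vec.independent {x, y, z} \<and> card {x, y, z} = 3"
    for x y z :: "'a ^ 3"
  proof -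
    have "UNIV \<subseteq> vec.span {x, y, z}"
      by (rule vec.card_ge_dim_independent) (use that in \<open>auto simp: card_cart_basis\<close>)
    then show ?thesis by auto
  qed
  have c0: "c \<noteq> 0" using m(3) vec.subspace_0[OF sub(3)] by auto
  have "d \<in> vec.span {a, b, c}" using full[OF indep[OF k(3,1,2) l(2,3) c0 sub(2)]] by simp
  then obtain \<alpha> \<beta> \<gamma> where "d - \<alpha> *s a - \<beta> *s b - \<gamma> *s c = 0"
    by (auto simp: vec.span_insert)
  then have d: "d = \<alpha> *s a + \<beta> *s b + \<gamma> *s c" by (simp add: algebra_simps)
  have "d \<in> k" if "\<alpha> = 0"
    unfolding d that using vec.subspace_add[OF sub(1)] vec.subspace_scale[OF sub(1)] k by simp
  moreover have "d \<in> l" if "\<beta> = 0"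
    unfolding d that using vec.subspace_add[OF sub(2)] vec.subspace_scale[OF sub(2)] l by simp
  moreover have "d \<in> m" if "\<gamma> = 0"
    unfolding d that using vec.subspace_add[OF sub(3)] vec.subspace_scale[OF sub(3)] m by simp
  ultimately have ne: "\<alpha> \<noteq> 0" "\<beta> \<noteq> 0" "\<gamma> \<noteq> 0" using k(4) l(4) m(4) by blast+
  have scale: "\<alpha> *s a \<in> S \<longleftrightarrow> a \<in> S" "\<beta> *s b \<in> S \<longleftrightarrow> b \<in> S" "\<gamma> *s c \<in> S \<longleftrightarrow> c \<in> S"
    if "vec.subspace S" for S
    using that by (simp_all only: subspace_scale_iff ne not_False_eq_True)
  have "\<gamma> *s c \<noteq> 0" using ne(3) c0 by simp
  then have "vec.span {\<alpha> *s a, \<beta> *s b, \<gamma> *s c} = UNIV"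
    using full[OF indep[OF _ _ _ _ _ _ sub(2)]] scale[OF sub(1)] scale[OF sub(2)] k l by meson
  then show ?thesis using that d scale by blast
qed

section \<open>The Latin squares of a net\<close>

definition line_through :: "(nat \<Rightarrow> 'l set set) \<Rightarrow> nat \<Rightarrow> 'l set \<Rightarrow> 'l set" where
  "line_through A k P = (THE n. n \<in> A k \<and> P \<subseteq> n)"

context
  fixes p :: nat and A :: "nat \<Rightarrow> ('a::field ^ 3) set set" and X :: "('a ^ 3) set set"
  assumes net: "is_net p A X"
begin

lemma lines: "\<forall>i\<in>{1..p}. A i \<noteq> {} \<and> finite (A i) \<and> A i \<subseteq> proj_lines"
  and points: "X \<subseteq> proj_points"
  and meets: "\<forall>i\<in>{1..p}. \<forall>j\<in>{1..p}. i \<noteq> j \<longrightarrow> (\<forall>l\<in>A i. \<forall>m\<in>A j. l \<inter> m \<in> X)"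
  and unique: "\<forall>P\<in>X. \<forall>i\<in>{1..p}. \<exists>!l. l \<in> A i \<and> P \<subseteq> l"
  using net unfolding is_net_def by - (elim conjE, assumption)+

lemma line_subspace: "k \<in> {1..p} \<Longrightarrow> n \<in> A k \<Longrightarrow> vec.subspace n"
  using lines unfolding proj_lines_def by blast

lemma meet_in_X:
  "\<lbrakk>i \<in> {1..p}; j \<in> {1..p}; i \<noteq> j; l \<in> A i; m \<in> A j\<rbrakk> \<Longrightarrow> l \<inter> m \<in> X"
  by (rule meets[rule_format])

lemma point: "P \<in> X \<Longrightarrow> vec.subspace P \<and> vec.dim P = 1"
  using points unfolding proj_points_def by blast

lemma line_through:
  assumes "P \<in> X" "k \<in> {1..p}"
  shows "line_through A k P \<in> A k" "P \<subseteq> line_through A k P"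
    "n \<in> A k \<Longrightarrow> P \<subseteq> n \<Longrightarrow> line_through A k P = n"
proof -
  have ex1: "\<exists>!n. n \<in> A k \<and> P \<subseteq> n" by (rule unique[rule_format, OF assms])
  from theI'[OF ex1] show "line_through A k P \<in> A k" "P \<subseteq> line_through A k P"
    unfolding line_through_def by auto
  show "n \<in> A k \<Longrightarrow> P \<subseteq> n \<Longrightarrow> line_through A k P = n"
    unfolding line_through_def by (rule the1_equality[OF ex1]) auto
qed

lemma point_nonzero: "P \<in> X \<Longrightarrow> \<exists>w\<in>P. w \<noteq> 0"
  using point[of P] vec.dim_eq_0[of P] by auto

lemma point_subset:
  assumes "P \<in> X" "w \<in> P" "w \<noteq> 0" "vec.subspace S" "w \<in> S"
  shows "P \<subseteq> S"
proof -
  have "vec.dim {w} = 1" using assms(3) by (simp add: vec.dim_eq_card_independent)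
  then have "vec.dim P \<le> vec.dim {w}" using point[OF assms(1)] by simp
  then have "P \<subseteq> vec.span {w}"
    using vec.dim_eq_span[of "{w}" P] vec.span_superset[of P] assms(2) by auto
  then show ?thesis using vec.span_minimal[of "{w}" S] assms(4,5) by auto
qed

text \<open>
Working with one nonzero vector of a point instead of the point turns incidence into membership.
\<close>

lemma vector_on_unique_line:
  assumes "P \<in> X" "w \<in> P" "w \<noteq> 0" "k \<in> {1..p}" "n \<in> A k" "n' \<in> A k" "w \<in> n" "w \<in> n'"
  shows "n = n'"
  using line_through(3)[OF assms(1,4,5)] line_through(3)[OF assms(1,4,6)]
    point_subset[OF assms(1-3) line_subspace[OF assms(4,5)] assms(7)]
    point_subset[OF assms(1-3) line_subspace[OF assms(4,6)] assms(8)] by simp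

lemma meet_eq:
  assumes "i \<in> {1..p}" "j \<in> {1..p}" "k \<in> {1..p}" "i \<noteq> j" "i \<noteq> k"
    and "l \<in> A i" "m \<in> A j" "n \<in> A k" "l \<inter> m \<subseteq> n"
  shows "l \<inter> n = l \<inter> m"
proof -
  have "l \<inter> m \<in> X" "l \<inter> n \<in> X"
    by (rule meet_in_X[OF assms(1,2,4,6,7)], rule meet_in_X[OF assms(1,3,5,6,8)])
  moreover have "l \<inter> m \<subseteq> l \<inter> n" using assms by blast
  ultimately show ?thesis using vec.subspace_dim_equal[of "l \<inter> m" "l \<inter> n"] point by auto
qed

lemma meet_row_bij:
  assumes "i \<in> {1..p}" "j \<in> {1..p}" "k \<in> {1..p}" "i \<noteq> j" "i \<noteq> k" "j \<noteq> k" "x \<in> A i"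
  shows "bij_betw (\<lambda>y. line_through A k (x \<inter> y)) (A j) (A k)"
proof -
  have inv: "line_through A j' (x \<inter> line_through A k' (x \<inter> y)) = y"
    if "j' \<in> {1..p}" "k' \<in> {1..p}" "i \<noteq> j'" "i \<noteq> k'" "y \<in> A j'" for j' k' y
  proof -
    have P: "x \<inter> y \<in> X" by (rule meet_in_X[OF assms(1) that(1,3) assms(7) that(5)])
    have "x \<inter> line_through A k' (x \<inter> y) = x \<inter> y"
      using meet_eq[OF assms(1) that(1,2,3,4) assms(7) that(5)] line_through(1,2)[OF P that(2)]
      by blast
    then show ?thesis using line_through(3)[OF P that(1,5)] by simp
  qed
  show ?thesis
  proof (rule bij_betw_byWitness[where f' = "\<lambda>z. line_through A j (x \<inter> z)"])
    show "\<forall>y\<in>A j. line_through A j (x \<inter> line_through A k (x \<inter> y)) = y"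
      using inv[OF assms(2,3,4,5)] by blast
    show "\<forall>z\<in>A k. line_through A k (x \<inter> line_through A j (x \<inter> z)) = z"
      using inv[OF assms(3,2,5,4)] by blast
    show "(\<lambda>y. line_through A k (x \<inter> y)) ` A j \<subseteq> A k"
      using line_through(1)[OF meet_in_X[OF assms(1,2,4,7)] assms(3)] by blast
    show "(\<lambda>z. line_through A j (x \<inter> z)) ` A k \<subseteq> A j"
      using line_through(1)[OF meet_in_X[OF assms(1,3,5,7)] assms(2)] by blast
  qed
qed

lemma net_latin_square:
  assumes "i \<in> {1..p}" "j \<in> {1..p}" "k \<in> {1..p}" "i \<noteq> j" "i \<noteq> k" "j \<noteq> k"
  shows "latin_square (A i) (A j) (A k) (\<lambda>x y. line_through A k (x \<inter> y))"
  unfolding latin_square_def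
  using meet_row_bij[of i j k] meet_row_bij[of j i k] assms by (simp add: Int_commute)

text \<open>
Of four concurrent lines from different classes, any two already determine the common point. This
transports incidences: a point found on \<open>v\<close> and one of the other lines lies on all of them.
\<close>

lemma concurrent:
  assumes "i \<in> {1..p}" "j \<in> {1..p}" "k \<in> {1..p}" "h \<in> {1..p}" "distinct [i, j, k, h]"
    and "x \<in> A i" "y \<in> A j" "line_through A k (x \<inter> y) = z" "line_through A h (x \<inter> y) = v"
  shows "x \<inter> z = x \<inter> y" "x \<inter> v = x \<inter> y" "y \<inter> v = x \<inter> y" "z \<inter> v = x \<inter> y"
proof -
  have ne: "i \<noteq> j" "i \<noteq> k" "i \<noteq> h" "j \<noteq> i" "j \<noteq> h" "k \<noteq> i" "k \<noteq> h"
    using assms(5) by auto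
  have P: "x \<inter> y \<in> X" by (rule meet_in_X[OF assms(1,2) ne(1) assms(6,7)])
  note z = line_through(1,2)[OF P assms(3), unfolded assms(8)]
    and v = line_through(1,2)[OF P assms(4), unfolded assms(9)]
  show xz: "x \<inter> z = x \<inter> y" by (rule meet_eq[OF assms(1,2,3) ne(1,2) assms(6,7) z])
  show "x \<inter> v = x \<inter> y" by (rule meet_eq[OF assms(1,2,4) ne(1,3) assms(6,7) v])
  have yx: "y \<inter> x \<subseteq> v" using v(2) by (simp only: Int_commute)
  show "y \<inter> v = x \<inter> y"
    using meet_eq[OF assms(2,1,4) ne(4,5) assms(7,6) v(1) yx] by (simp only: Int_commute)
  have zx: "z \<inter> x = x \<inter> y" using xz by (simp only: Int_commute)
  then have "z \<inter> x \<subseteq> v" using v(2) by simp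
  then show "z \<inter> v = x \<inter> y"
    using meet_eq[OF assms(3,1,4) ne(6,7) z(1) assms(6) v(1)] zx by simp
qed

lemma net_orthogonal:
  assumes "i \<in> {1..p}" "j \<in> {1..p}" "k \<in> {1..p}" "h \<in> {1..p}" "distinct [i, j, k, h]"
    and "x \<in> A i" "y \<in> A j" "x' \<in> A i" "y' \<in> A j"
    and "line_through A k (x \<inter> y) = line_through A k (x' \<inter> y')"
      "line_through A h (x \<inter> y) = line_through A h (x' \<inter> y')"
  shows "x = x' \<and> y = y'"
proof -
  have "x \<inter> y = line_through A k (x \<inter> y) \<inter> line_through A h (x \<inter> y)"
    by (rule concurrent(4)[OF assms(1-7) refl refl, symmetric])
  also have "\<dots> = line_through A k (x' \<inter> y') \<inter> line_through A h (x' \<inter> y')"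
    by (rule arg_cong2[OF assms(10,11), of "(\<inter>)"])
  also have "\<dots> = x' \<inter> y'"
    by (rule concurrent(4)[OF assms(1-5,8,9) refl refl])
  finally have sub: "x \<inter> y \<subseteq> x'" "x \<inter> y \<subseteq> y'" by (simp_all only: Int_lower1 Int_lower2)
  have "i \<noteq> j" using assms(5) by simp
  then have P: "x \<inter> y \<in> X" using meet_in_X[OF assms(1,2) _ assms(6,7)] by blast
  have "x = x'"
    using line_through(3)[OF P assms(1,6) Int_lower1] line_through(3)[OF P assms(1,8) sub(1)]
    by (rule trans[OF sym])
  moreover have "y = y'"
    using line_through(3)[OF P assms(2,7) Int_lower2] line_through(3)[OF P assms(2,9) sub(2)]
    by (rule trans[OF sym])
  ultimately show ?thesis by (rule conjI)
qed

end

section \<open>Nonexistence of (4,4)-nets\<close>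

theorem mainTheorem5:
  assumes "CHAR('a::field) \<noteq> 2"
  shows "\<not> (\<exists>(A :: nat \<Rightarrow> ('a ^ 3) set set) X. is_net_of_degree 4 4 A X)"
proof
  assume "\<exists>(A :: nat \<Rightarrow> ('a ^ 3) set set) X. is_net_of_degree 4 4 A X"
  then obtain A :: "nat \<Rightarrow> ('a ^ 3) set set" and X where
    net: "is_net 4 A X" and deg: "\<forall>i\<in>{1..4}. card (A i) = 4"
    unfolding is_net_of_degree_def by blast
  define f where "f = (\<lambda>x y. line_through A 3 (x \<inter> y))"
  define g where "g = (\<lambda>x y. line_through A 4 (x \<inter> y))"
  have F: "latin_square (A 1) (A 2) (A 3) f" and G: "latin_square (A 1) (A 2) (A 4) g"
    unfolding f_def g_def by (rule net_latin_square[OF net]; simp)+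
  have orth: "x = x' \<and> y = y'"
    if "x \<in> A 1" "y \<in> A 2" "x' \<in> A 1" "y' \<in> A 2" "f x y = f x' y'" "g x y = g x' y'" for x y x' y'
    by (rule net_orthogonal[OF net, of 1 2 3 4]) (use that in \<open>simp_all add: f_def g_def\<close>)
  have card: "card (A 1) = 4" "card (A 2) = 4" "card (A 3) = 4" "card (A 4) = 4"
    using deg by auto
  obtain x0 x1 x2 x3 y0 y1 y2 y3 z0 z1 z2 z3 v0 v1 v2 v3 where
    xA: "{x0, x1, x2, x3} \<subseteq> A 1" and xd: "distinct [x0, x1, x2, x3]" and
    yA: "{y0, y1, y2, y3} \<subseteq> A 2" and yd: "distinct [y0, y1, y2, y3]" and
    zA: "{z0, z1, z2, z3} \<subseteq> A 3" and zd: "distinct [z0, z1, z2, z3]" and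
    vA: "{v0, v1, v2, v3} \<subseteq> A 4" and vd: "distinct [v0, v1, v2, v3]" and
    f: "f x0 y0 = z0" "f x0 y1 = z1" "f x0 y2 = z2" "f x0 y3 = z3"
      "f x1 y0 = z1" "f x1 y1 = z0" "f x1 y2 = z3"
      "f x2 y0 = z2" "f x2 y2 = z0" "f x2 y3 = z1"
      "f x3 y0 = z3" "f x3 y1 = z2" "f x3 y3 = z0" and
    g: "g x0 y0 = v0" "g x0 y1 = v2" "g x0 y2 = v3" "g x0 y3 = v1"
      "g x1 y0 = v1" "g x1 y1 = v3" "g x1 y2 = v2"
      "g x2 y0 = v2" "g x2 y2 = v1" "g x2 y3 = v3"
      "g x3 y0 = v3" "g x3 y1 = v1" "g x3 y3 = v2"
    by (rule orthogonal_latin_squares_4[OF F G card orth]) (assumption | rule that)+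
  have idx: "1 \<in> {1..4::nat}" "2 \<in> {1..4::nat}" "3 \<in> {1..4::nat}" "4 \<in> {1..4::nat}"
    "distinct [1, 2, 3, 4 :: nat]" by auto
  have xs: "x0 \<in> A 1" "x1 \<in> A 1" "x2 \<in> A 1" "x3 \<in> A 1" and ys: "y0 \<in> A 2" "y1 \<in> A 2" "y2 \<in> A 2" "y3 \<in> A 2"
    and zs: "z0 \<in> A 3" "z1 \<in> A 3" "z2 \<in> A 3" "z3 \<in> A 3" and vs: "v0 \<in> A 4" "v1 \<in> A 4" "v2 \<in> A 4" "v3 \<in> A 4"
    using xA yA zA vA by auto
  have conc: "w \<in> x \<and> w \<in> y \<and> w \<in> z"
    if "x \<in> A 1" "y \<in> A 2" "f x y = z" "g x y = v" "w \<in> v" "w \<in> x \<or> w \<in> y \<or> w \<in> z"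
    for x y z v w
  proof -
    have "line_through A 3 (x \<inter> y) = z" "line_through A 4 (x \<inter> y) = v"
      using that(3,4) by (simp_all only: f_def g_def)
    note meets = concurrent[OF net idx that(1,2) this]
    have "w \<in> x \<inter> v \<or> w \<in> y \<inter> v \<or> w \<in> z \<inter> v" using that(5,6) by blast
    then have "w \<in> x \<inter> y" unfolding meets by blast
    moreover from this have "w \<in> x \<inter> z" unfolding meets .
    ultimately show ?thesis by blast
  qed
  \<comment> \<open>Numbered in the order \<open>x0, \<dots>, x3, y0, \<dots>, y3, z0, \<dots>, z3, v0, \<dots>, v3\<close>.\<close>
  note sub = line_subspace[OF net idx(1) xs(1)] line_subspace[OF net idx(1) xs(2)]
    line_subspace[OF net idx(1) xs(3)] line_subspace[OF net idx(1) xs(4)]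
    line_subspace[OF net idx(2) ys(1)] line_subspace[OF net idx(2) ys(2)]
    line_subspace[OF net idx(2) ys(3)] line_subspace[OF net idx(2) ys(4)]
    line_subspace[OF net idx(3) zs(1)] line_subspace[OF net idx(3) zs(2)]
    line_subspace[OF net idx(3) zs(3)] line_subspace[OF net idx(3) zs(4)]
    line_subspace[OF net idx(4) vs(1)] line_subspace[OF net idx(4) vs(2)]
    line_subspace[OF net idx(4) vs(3)] line_subspace[OF net idx(4) vs(4)]
  have base: "\<exists>w. w \<noteq> 0 \<and> w \<in> x \<and> w \<in> y \<and> w \<in> f x y \<and> w \<in> g x y \<and>
      (\<forall>n\<in>A 1. w \<in> n \<longrightarrow> n = x) \<and> (\<forall>n\<in>A 2. w \<in> n \<longrightarrow> n = y) \<and>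
      (\<forall>n\<in>A 3. w \<in> n \<longrightarrow> n = f x y) \<and> (\<forall>n\<in>A 4. w \<in> n \<longrightarrow> n = g x y)"
    if xy: "x \<in> A 1" "y \<in> A 2" for x y
  proof -
    have P: "x \<inter> y \<in> X" using meet_in_X[OF net idx(1,2) _ xy] by simp
    obtain w where w: "w \<in> x \<inter> y" "w \<noteq> 0" using point_nonzero[OF net P] by blast
    note u = vector_on_unique_line[OF net P w]
    have z: "f x y \<in> A 3" "w \<in> f x y" and v: "g x y \<in> A 4" "w \<in> g x y"
      using line_through(1,2)[OF net P idx(3)] line_through(1,2)[OF net P idx(4)] w
      unfolding f_def g_def by blast+
    show ?thesis
      using w z v u[OF idx(1) _ xy(1)] u[OF idx(2) _ xy(2)] u[OF idx(3) _ z(1)] u[OF idx(4) _ v(1)]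
      by blast
  qed
  \<comment> \<open>The vertices of the quadrangle: \<open>a0\<close> lists the lines through \<open>a\<close>, and \<open>a1\<close> says that no other
    line of the net passes through it; likewise for \<open>b\<close>, \<open>c\<close>, \<open>d\<close>.\<close>
  obtain a where a0: "a \<in> x1" "a \<in> y0" "a \<in> z1" "a \<in> v1"
      and a1: "\<forall>n\<in>A 1. a \<in> n \<longrightarrow> n = x1" "\<forall>n\<in>A 2. a \<in> n \<longrightarrow> n = y0"
        "\<forall>n\<in>A 3. a \<in> n \<longrightarrow> n = z1" "\<forall>n\<in>A 4. a \<in> n \<longrightarrow> n = v1"
    using base[OF xs(2) ys(1)] f g by auto
  obtain b where b0: "b \<in> x0" "b \<in> y1" "b \<in> z1" "b \<in> v2"
      and b1: "\<forall>n\<in>A 1. b \<in> n \<longrightarrow> n = x0" "\<forall>n\<in>A 2. b \<in> n \<longrightarrow> n = y1"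
        "\<forall>n\<in>A 3. b \<in> n \<longrightarrow> n = z1" "\<forall>n\<in>A 4. b \<in> n \<longrightarrow> n = v2"
    using base[OF xs(1) ys(2)] f g by auto
  obtain c where c0: "c \<in> x1" "c \<in> y1" "c \<in> z0" "c \<in> v3"
      and c1: "\<forall>n\<in>A 1. c \<in> n \<longrightarrow> n = x1" "\<forall>n\<in>A 2. c \<in> n \<longrightarrow> n = y1"
        "\<forall>n\<in>A 3. c \<in> n \<longrightarrow> n = z0" "\<forall>n\<in>A 4. c \<in> n \<longrightarrow> n = v3"
    using base[OF xs(2) ys(2)] f g by auto
  obtain d where d0: "d \<in> x0" "d \<in> y0" "d \<in> z0" "d \<in> v0"
      and d1: "\<forall>n\<in>A 1. d \<in> n \<longrightarrow> n = x0" "\<forall>n\<in>A 2. d \<in> n \<longrightarrow> n = y0"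
        "\<forall>n\<in>A 3. d \<in> n \<longrightarrow> n = z0" "\<forall>n\<in>A 4. d \<in> n \<longrightarrow> n = v0"
    using base[OF xs(1) ys(1)] f g by auto
  have ne: "x2 \<noteq> x1" "x3 \<noteq> x1" "x1 \<noteq> x0" "y2 \<noteq> y1" "y3 \<noteq> y1" "y1 \<noteq> y0"
    "z2 \<noteq> z1" "z3 \<noteq> z1" "z1 \<noteq> z0" "v1 \<noteq> v0" "v2 \<noteq> v0" "v3 \<noteq> v0"
    "v2 \<noteq> v1" "v3 \<noteq> v1" "v3 \<noteq> v2"
    using xd yd zd vd by auto
  have a2: "a \<notin> x2" "a \<notin> x3" "a \<notin> y1" "a \<notin> v2" "a \<notin> v3"
    using a1 ne xs ys vs by metis+
  have b2: "b \<notin> z2" "b \<notin> z3" "b \<notin> x1" "b \<notin> v1" "b \<notin> v3"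
    using b1 ne xs zs vs by metis+
  have c2: "c \<notin> y2" "c \<notin> y3" "c \<notin> z1" "c \<notin> v1" "c \<notin> v2"
    using c1 ne ys zs vs by metis+
  have d2: "d \<notin> x1" "d \<notin> y1" "d \<notin> z1" "d \<notin> v1" "d \<notin> v2" "d \<notin> v3"
    using d1 ne xs ys zs vs by metis+
  obtain a' b' c' where span: "vec.span {a', b', c'} = UNIV" and d: "d = a' + b' + c'"
    and a': "\<And>S. vec.subspace S \<Longrightarrow> a' \<in> S \<longleftrightarrow> a \<in> S"
    and b': "\<And>S. vec.subspace S \<Longrightarrow> b' \<in> S \<longleftrightarrow> b \<in> S"
    and c': "\<And>S. vec.subspace S \<Longrightarrow> c' \<in> S \<longleftrightarrow> c \<in> S"
    using frame_scaling[OF sub(6,2,10) b0(2) c0(2) a2(3) d2(2) a0(1) c0(1) b2(3) d2(1)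
        a0(3) b0(3) c2(3) d2(3)] by blast
  \<comment> \<open>The incidences of the original representatives, restated for the rescaled ones.\<close>
  note a3 = a0[folded a'[OF sub(2)] a'[OF sub(5)] a'[OF sub(10)] a'[OF sub(14)]]
      a2[folded a'[OF sub(3)] a'[OF sub(4)] a'[OF sub(6)] a'[OF sub(15)] a'[OF sub(16)]]
    and b3 = b0[folded b'[OF sub(1)] b'[OF sub(6)] b'[OF sub(10)] b'[OF sub(15)]]
      b2[folded b'[OF sub(11)] b'[OF sub(12)] b'[OF sub(2)] b'[OF sub(14)] b'[OF sub(16)]]
    and c3 = c0[folded c'[OF sub(2)] c'[OF sub(6)] c'[OF sub(9)] c'[OF sub(16)]]
      c2[folded c'[OF sub(7)] c'[OF sub(8)] c'[OF sub(10)] c'[OF sub(14)] c'[OF sub(15)]]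
  have d_cyc: "b' + c' + a' = d" "c' + a' + b' = d" using d by (simp_all add: ac_simps)
  have span_cyc: "vec.span {b', c', a'} = UNIV" "vec.span {c', a', b'} = UNIV"
    using span by (simp_all add: insert_commute)
  have w1: "\<exists>w. w \<in> v1 \<and> w \<in> y1 \<and> w \<noteq> 0"
    using point_nonzero[OF net meet_in_X[OF net idx(4,2) _ vs(2) ys(2)]] by auto
  have w2: "\<exists>w. w \<in> v2 \<and> w \<in> x1 \<and> w \<noteq> 0"
    using point_nonzero[OF net meet_in_X[OF net idx(4,1) _ vs(3) xs(2)]] by auto
  have w3: "\<exists>w. w \<in> v3 \<and> w \<in> z1 \<and> w \<noteq> 0"
    using point_nonzero[OF net meet_in_X[OF net idx(4,3) _ vs(4) zs(2)]] by auto
  note da = d0[unfolded d] d2[unfolded d]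
  note db = d0[folded d_cyc(1)] d2[folded d_cyc(1)]
  note dc = d0[folded d_cyc(2)] d2[folded d_cyc(2)]
  obtain m1 where m1: "m1 \<noteq> 0" "m1 \<noteq> 1" "m1 *s b' + c' \<in> v1" "m1 *s b' + c' \<in> y1"
    using w1 slope[OF span sub(14) a3(4) b3(8) c3(8) da(8) sub(6) a3(7) b3(2) c3(2)] by blast
  obtain m2 where m2: "m2 \<noteq> 0" "m2 \<noteq> 1" "m2 *s c' + a' \<in> v2" "m2 *s c' + a' \<in> x1"
    using w2 slope[OF span_cyc(1) sub(15) b3(4) c3(9) a3(8) db(9) sub(2) b3(7) c3(1) a3(1)] by blast
  obtain m3 where m3: "m3 \<noteq> 0" "m3 \<noteq> 1" "m3 *s a' + b' \<in> v3" "m3 *s a' + b' \<in> z1"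
    using w3 slope[OF span_cyc(2) sub(16) c3(4) a3(9) b3(9) dc(10) sub(10) c3(7) a3(3) b3(3)] by blast
  note p1 = slope_points[OF sub(14) a3(4) m1(3) sub(1) b3(1) da(1) sub(9) c3(3) da(3)]
  note p2 = slope_points[OF sub(15) b3(4) m2(3) sub(9) c3(3) db(3) sub(5) a3(2) db(2)]
  note p3 = slope_points[OF sub(16) c3(4) m3(3) sub(5) a3(2) dc(2) sub(1) b3(1) dc(1)]
  \<comment> \<open>Each of the nine points is known to lie on some \<open>v\<^sub>h\<close> and on one side of the quadrangle; the
    tables of \<open>f\<close> and \<open>g\<close> name the two further lines through it.\<close>
  have q1: "a' + m1 *s b' + c' \<in> y3 \<inter> z3" "m1 *s b' + c' \<in> x3 \<inter> z2"
      "m1 *s a' + m1 *s b' + c' \<in> x2 \<inter> y2"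
    using conc[OF xs(1) ys(4) f(4) g(4), of "a' + m1 *s b' + c'"]
      conc[OF xs(4) ys(2) f(12) g(12) m1(3)]
      conc[OF xs(3) ys(3) f(9) g(9), of "m1 *s a' + m1 *s b' + c'"] p1 m1(4) by blast+
  have q2: "m2 *s c' + a' \<in> y2 \<inter> z3" "m2 *s b' + m2 *s c' + a' \<in> x2 \<inter> z2"
      "b' + m2 *s c' + a' \<in> x3 \<inter> y3"
    using conc[OF xs(2) ys(3) f(7) g(7) m2(3)]
      conc[OF xs(3) ys(1) f(8) g(8), of "m2 *s b' + m2 *s c' + a'"]
      conc[OF xs(4) ys(4) f(13) g(13), of "b' + m2 *s c' + a'"] p2 m2(4) by blast+
  have q3: "m3 *s c' + m3 *s a' + b' \<in> y2 \<inter> z2" "c' + m3 *s a' + b' \<in> x3 \<inter> z3"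
      "m3 *s a' + b' \<in> x2 \<inter> y3"
    using conc[OF xs(1) ys(3) f(3) g(3), of "m3 *s c' + m3 *s a' + b'"]
      conc[OF xs(4) ys(1) f(11) g(11), of "c' + m3 *s a' + b'"]
      conc[OF xs(3) ys(4) f(10) g(10) m3(3)] p3 m3(4) by blast+
  note q1' = q1[THEN IntD1] q1[THEN IntD2] and q2' = q2[THEN IntD1] q2[THEN IntD2]
    and q3' = q3[THEN IntD1] q3[THEN IntD2]
  \<comment> \<open>The three pairs \<open>x2, x3\<close>, then \<open>z2, z3\<close>, then \<open>y2, y3\<close> are cyclic shifts of each other.\<close>
  have "m1 + m3 = 0"
    by (rule opposite_slopes[OF sub(3) a3(5) sub(4) a3(6)
          q1'(3) q2'(2) q3'(3) q1'(2) q2'(3) q3'(2) m2(2)])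
  moreover have "m2 + m1 = 0"
    by (rule opposite_slopes[OF sub(11) b3(5) sub(12) b3(6)
          q2'(5) q3'(4) q1'(5) q2'(4) q3'(5) q1'(4) m3(2)])
  moreover have "m3 + m2 = 0"
    by (rule opposite_slopes[OF sub(7) c3(5) sub(8) c3(6)
          q3'(1) q1'(6) q2'(1) q3'(6) q1'(1) q2'(6) m1(2)])
  ultimately have "2 * m1 = 0" by algebra
  then have "of_nat 2 = (0 :: 'a)" using m1(1) by simp
  then have "CHAR('a) dvd 2" by (simp only: of_nat_eq_0_iff_char_dvd)
  then have "CHAR('a) = 1 \<or> CHAR('a) = 2" using two_is_prime_nat prime_nat_iff by blast
  then show False using assms CHAR_not_1 by auto
qed

end
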